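(* Let $n,p\ge1$, $\mathbf{X}\in\mathbb{R}^{n\times p}$ fixed, $\beta^0\in\mathbb{R}^p$, and $\mathbf{Y}=\mathbf{X}\beta^0+\varepsilon$ with $\varepsilon_i$ i.i.d. $\mathcal{N}(0,\sigma^2)$, $\sigma>0$. Let $\lambda>0$ with $\Omega_{\min}(\lambda)>0$, let $\hat\beta_{\mathrm{init}}$ be an estimator of $\beta^0$, and assume (A'): there are constants $\Delta_j>0$ and $0<\kappa<1$ such that $$\mathbb{P}\Big[\bigcap_{j=1}^{p}\Big\{\Big|a_{n,p;j}(\sigma)\sum_{k\neq j}(P_{\mathbf{X}})_{jk}(\hat\beta_{\mathrm{init};k}-\beta^0_k)\Big|\le\Delta_j\Big\}\Big]\ge1-\kappa.$$ Let $Z=\hat\beta-\mathbb{E}[\hat\beta]$, so $Z\sim\mathcal{N}_p(0,n^{-1}\sigma^2\Omega(\lambda))$. Then $$\|a_{n,p}b(\lambda)\|_\infty:=\max_{1\le j\le p}a_{n,p;j}(\sigma)|b_j(\lambda)|\le\frac{\lambda}{\Omega_{\min}(\lambda)^{1/2}}\,n^{1/2}\sigma^{-1}\|\theta^0\|_2\,\lambda_{\min\neq0}(\hat\Sigma)^{-1},$$ and with probability at least $1-\kappa$ the following hold simultaneously: for every $j$ with $\beta^0_j=0$, $a_{n,p;j}(\sigma)|\hat\beta_{\mathrm{corr};j}|\le a_{n,p;j}(\sigma)|Z_j|+\Delta_j+\|a_{n,p}b(\lambda)\|_\infty$; and for every $G\subseteq\{1,\ldots,p\}$ with $\beta^0_j=0$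 for all $j\in G$, $\max_{j\in G}a_{n,p;j}(\sigma)|\hat\beta_{\mathrm{corr};j}|\le\max_{j\in G}\big(a_{n,p;j}(\sigma)|Z_j|+\Delta_j\big)+\|a_{n,p}b(\lambda)\|_\infty$.
   Context: $\hat\Sigma=n^{-1}\mathbf{X}^T\mathbf{X}$; $P_{\mathbf{X}}=\mathbf{X}^T(\mathbf{X}\mathbf{X}^T)^{-}\mathbf{X}$ (Moore–Penrose pseudo-inverse); $\theta^0=P_{\mathbf{X}}\beta^0$; $\Omega(\lambda)=(\hat\Sigma+\lambda I)^{-1}\hat\Sigma(\hat\Sigma+\lambda I)^{-1}$, $\Omega_{\min}(\lambda)=\min_j\Omega_{jj}(\lambda)$; $\lambda_{\min\neq0}(A)$ = smallest nonzero eigenvalue of symmetric $A$; $a_{n,p;j}(\sigma)=n^{1/2}\sigma^{-1}\Omega_{jj}(\lambda)^{-1/2}$. Ridge $\hat\beta=(\hat\Sigma+\lambda I)^{-1}n^{-1}\mathbf{X}^T\mathbf{Y}$; $b_j(\lambda)=\mathbb{E}[\hat\beta_j]-\theta^0_j$; $\hat\beta_{\mathrm{corr};j}=\hat\beta_j-\sum_{k\neq j}(P_{\mathbf{X}})_{jk}\hat\beta_{\mathrm{init};k}$. *)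

theory Defs
  imports "HOL-Analysis.Analysis" "HOL-Probability.Probability"
begin

text \<open>Moore--Penrose pseudo-inverse, defined by the four Penrose conditions.\<close>
definition mp_pinv :: "real^'m^'k \<Rightarrow> real^'k^'m" where
  "mp_pinv A = (THE B. A ** B ** A = A \<and> B ** A ** B = B \<and>
                      transpose (A ** B) = A ** B \<and> transpose (B ** A) = B ** A)"

text \<open>Design matrix X has n rows (index type 'n) and p columns (index type 'p).\<close>
definition Sigma_hat :: "real^'p^'n \<Rightarrow> real^'p^'p" where
  "Sigma_hat X = inverse (real CARD('n)) *\<^sub>R (transpose X ** X)"

definition proj_X :: "real^'p^'n \<Rightarrow> real^'p^'p" where
  "proj_X X = transpose X ** mp_pinv (X ** transpose X) ** X"

definition Omega :: "real^'p^'n \<Rightarrow> real \<Rightarrow> real^'p^'p" where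
  "Omega X lam = matrix_inv (Sigma_hat X + lam *\<^sub>R mat 1) ** Sigma_hat X
                 ** matrix_inv (Sigma_hat X + lam *\<^sub>R mat 1)"

definition Omega_min :: "real^'p^'n \<Rightarrow> real \<Rightarrow> real" where
  "Omega_min X lam = Min (range (\<lambda>j. Omega X lam $ j $ j))"

text \<open>Smallest nonzero eigenvalue of a (symmetric) square matrix.\<close>
definition min_nonzero_eig :: "real^'p^'p \<Rightarrow> real" where
  "min_nonzero_eig A = Min {\<mu>. \<mu> \<noteq> 0 \<and> (\<exists>v. v \<noteq> 0 \<and> A *v v = \<mu> *\<^sub>R v)}"

definition a_coef :: "real^'p^'n \<Rightarrow> real \<Rightarrow> real \<Rightarrow> 'p \<Rightarrow> real" where
  "a_coef X lam \<sigma> j = sqrt (real CARD('n)) / \<sigma> / sqrt (Omega X lam $ j $ j)"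

text \<open>Ridge estimator as a function of the response vector Y.\<close>
definition ridge :: "real^'p^'n \<Rightarrow> real \<Rightarrow> real^'n \<Rightarrow> real^'p" where
  "ridge X lam Y = matrix_inv (Sigma_hat X + lam *\<^sub>R mat 1)
                     *v (inverse (real CARD('n)) *\<^sub>R (transpose X *v Y))"

text \<open>Law of the noise vector: i.i.d. N(0, sigma^2) coordinates.\<close>
definition gauss_noise :: "real \<Rightarrow> (real^'n) measure" where
  "gauss_noise \<sigma> = density lborel (\<lambda>e. \<Prod>i\<in>UNIV. ennreal (normal_density 0 \<sigma> (e $ i)))"

end

theory Submission
  imports Defs
begin

(*
  The ridge estimator is affine in the Gaussian noise, so its mean is
  (Sigma_hat + lam I)^-1 Sigma_hat beta0.  The Penrose identities give X P_X = X, hence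
  Sigma_hat theta0 = Sigma_hat beta0 and the bias equals -lam (Sigma_hat + lam I)^-1 theta0.
  This vector lies in the row space of X, where |Sigma_hat w| >= lambda_min_nonzero |w|, and
  |Sigma_hat (Sigma_hat + lam I)^-1 theta0| <= |theta0| by positivity; together with
  a_j <= n^(1/2) sigma^-1 Omega_min^(-1/2) this bounds every a_j |b_j|.
  If beta0_j = 0, the corrected estimator splits as Z_j + b_j minus the error term of the
  initial estimator that assumption (A') controls, so the coordinatewise bounds hold on the
  event of (A'), and the bounds over groups follow by taking maxima.
*)

section \<open>Gaussian noise\<close>

lemma nn_integral_lborel_prod_cart:
  fixes f :: "'n::finite \<Rightarrow> real \<Rightarrow> ennreal"
  assumes [measurable]: "\<And>i. f i \<in> borel_measurable borel"
  shows "(\<integral>\<^sup>+e. (\<Prod>i\<in>UNIV. f i (e $ i)) \<partial>(lborel :: (real^'n) measure))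
       = (\<Prod>i\<in>UNIV. \<integral>\<^sup>+x. f i x \<partial>lborel)"
proof -
  have basis: "(Basis :: (real^'n) set) = (\<lambda>i. axis i 1) ` UNIV"
    by (auto simp: Basis_vec_def)
  have inj: "inj (\<lambda>i::'n. axis i (1::real))"
    by (auto simp: inj_def axis_eq_axis)
  define g where "g b = f (SOME i. b = axis i 1)" for b :: "real^'n"
  have g_axis: "g (axis i 1) = f i" for i
  proof -
    have "(SOME j. axis i (1::real) = axis j 1) = i"
      by (rule some_equality) (auto simp: axis_eq_axis)
    then show ?thesis by (simp add: g_def)
  qed
  have "(\<integral>\<^sup>+e. (\<Prod>b\<in>Basis. g b (e \<bullet> b)) \<partial>(lborel :: (real^'n) measure))
      = (\<Prod>b\<in>Basis. \<integral>\<^sup>+x. g b x \<partial>lborel)"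
    by (rule nn_integral_lborel_prod) (auto simp: basis g_axis)
  then show ?thesis
    unfolding basis prod.reindex[OF inj] by (simp add: g_axis cart_eq_inner_axis)
qed

lemma
  shows space_gauss_noise [simp]: "space (gauss_noise \<sigma>) = UNIV"
    and sets_gauss_noise [simp, measurable_cong]: "sets (gauss_noise \<sigma>) = sets borel"
  by (simp_all add: gauss_noise_def)

lemma nn_integral_gauss_noise_nth:
  fixes g :: "real \<Rightarrow> ennreal"
  assumes "\<sigma> > 0" and [measurable]: "g \<in> borel_measurable borel"
  shows "(\<integral>\<^sup>+e. g (e $ i) \<partial>(gauss_noise \<sigma> :: (real^'n::finite) measure))
       = (\<integral>\<^sup>+x. g x * normal_density 0 \<sigma> x \<partial>lborel)"
proof -
  define f where "f k = (if k = i then (\<lambda>x. g x * normal_density 0 \<sigma> x)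
                                  else (\<lambda>x. ennreal (normal_density 0 \<sigma> x)))" for k
  have [measurable]: "f k \<in> borel_measurable borel" for k
    by (simp add: f_def)
  have "(\<Prod>k\<in>UNIV. ennreal (normal_density 0 \<sigma> (e $ k))) * g (e $ i)
      = (\<Prod>k\<in>UNIV. f k (e $ k))" for e :: "real^'n"
    by (simp add: f_def prod.remove[of UNIV i] mult_ac)
  then have "(\<integral>\<^sup>+e. g (e $ i) \<partial>(gauss_noise \<sigma> :: (real^'n) measure))
      = (\<Prod>k\<in>UNIV. \<integral>\<^sup>+x. f k x \<partial>lborel)"
    unfolding gauss_noise_def
    by (simp add: nn_integral_density nn_integral_lborel_prod_cart)
  also have "\<dots> = (\<integral>\<^sup>+x. f i x \<partial>lborel)"
    using assms(1) by (simp add: f_def prod.remove[of UNIV i] nn_integral_eq_integral)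
  finally show ?thesis by (simp add: f_def)
qed

lemma prob_space_gauss_noise:
  assumes "\<sigma> > 0"
  shows "prob_space (gauss_noise \<sigma> :: (real^'n::finite) measure)"
proof
  let ?M = "gauss_noise \<sigma> :: (real^'n) measure"
  have "emeasure ?M (space ?M) = (\<integral>\<^sup>+e. 1 \<partial>?M)"
    by simp
  also have "\<dots> = (\<integral>\<^sup>+x. normal_density 0 \<sigma> x \<partial>lborel)"
    using nn_integral_gauss_noise_nth[OF assms, of "\<lambda>_. 1" undefined] by simp
  also have "\<dots> = 1"
    using assms by (simp add: nn_integral_eq_integral)
  finally show "emeasure ?M (space ?M) = 1" .
qed

lemma distributed_gauss_noise_nth:
  assumes "\<sigma> > 0"
  shows "distributed (gauss_noise \<sigma> :: (real^'n::finite) measure) lborel (\<lambda>e. e $ i)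
           (\<lambda>x. ennreal (normal_density 0 \<sigma> x))"
proof -
  have "emeasure (gauss_noise \<sigma>) ((\<lambda>e::real^'n. e $ i) -` A)
      = (\<integral>\<^sup>+x. ennreal (normal_density 0 \<sigma> x) * indicator A x \<partial>lborel)" if "A \<in> sets borel" for A
  proof -
    have "(\<lambda>e::real^'n. e $ i) -` A \<in> sets borel"
      using that by (simp add: vimage_def)
    then have "emeasure (gauss_noise \<sigma>) ((\<lambda>e::real^'n. e $ i) -` A)
        = (\<integral>\<^sup>+e. indicator ((\<lambda>e. e $ i) -` A) e \<partial>(gauss_noise \<sigma> :: (real^'n) measure))"
      by simp
    also have "\<dots> = (\<integral>\<^sup>+e. indicator A (e $ i) \<partial>gauss_noise \<sigma>)"
      by (simp add: indicator_def)
    finally show ?thesis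
      using assms that by (simp add: nn_integral_gauss_noise_nth mult.commute)
  qed
  then show ?thesis
    unfolding distributed_def
    by (intro conjI measure_eqI) (auto simp: emeasure_distr emeasure_density)
qed

lemma
  fixes i :: "'n::finite"
  assumes "\<sigma> > 0"
  shows integrable_gauss_noise_nth: "integrable (gauss_noise \<sigma>) (\<lambda>e::real^'n. e $ i)"
    and integral_gauss_noise_nth: "(\<integral>e. e $ i \<partial>(gauss_noise \<sigma> :: (real^'n) measure)) = 0"
proof -
  interpret prob_space "gauss_noise \<sigma> :: (real^'n) measure"
    using assms by (rule prob_space_gauss_noise)
  show "integrable (gauss_noise \<sigma>) (\<lambda>e::real^'n. e $ i)"
    by (rule distributed_integrable_var[OF distributed_gauss_noise_nth[OF assms] _
          integrable_normal_moment_nz_1[OF assms]]) simp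
  show "(\<integral>e. e $ i \<partial>(gauss_noise \<sigma> :: (real^'n) measure)) = 0"
    by (rule normal_distributed_expectation[OF assms distributed_gauss_noise_nth[OF assms]])
qed

lemma integral_gauss_noise_affine:
  fixes A :: "real^'n::finite^'m::finite"
  assumes "\<sigma> > 0"
  shows "(\<integral>e. (c + A *v e) $ j \<partial>gauss_noise \<sigma>) = c $ j"
proof -
  interpret prob_space "gauss_noise \<sigma> :: (real^'n) measure"
    using assms by (rule prob_space_gauss_noise)
  have int: "integrable (gauss_noise \<sigma>) (\<lambda>e::real^'n. A $ j $ i * e $ i)" for i
    by (intro integrable_mult_right integrable_gauss_noise_nth[OF assms])
  have "(\<integral>e. (c + A *v e) $ j \<partial>gauss_noise \<sigma>)
      = c $ j + (\<Sum>i\<in>UNIV. \<integral>e. A $ j $ i * e $ i \<partial>(gauss_noise \<sigma> :: (real^'n) measure))"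
    using int by (simp add: matrix_vector_mult_def integral_sum prob_space flip: space_gauss_noise)
  then show ?thesis
    using assms by (simp add: integral_gauss_noise_nth)
qed

section \<open>Matrix identities\<close>

lemma invertible_iff_kernel_zero:
  fixes A :: "real^'n::finite^'n"
  shows "invertible A \<longleftrightarrow> (\<forall>x. A *v x = 0 \<longrightarrow> x = 0)"
  by (simp add: invertible_left_inverse matrix_left_invertible_ker)

lemma matrix_inv_inverse:
  fixes A :: "real^'n::finite^'n"
  assumes "invertible A"
  shows "A ** matrix_inv A = mat 1" and "matrix_inv A ** A = mat 1"
proof -
  have "\<exists>A'. A ** A' = mat 1 \<and> A' ** A = mat 1"
    using assms by (simp add: invertible_def)
  from someI_ex[OF this] show "A ** matrix_inv A = mat 1" "matrix_inv A ** A = mat 1"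
    by (simp_all add: matrix_inv_def)
qed

lemma matrix_diff_ldistrib: "(A::real^'n::finite^'m) ** (B - C) = A ** B - A ** C"
  by (simp add: matrix_matrix_mult_def vec_eq_iff sum_subtractf right_diff_distrib)

lemma matrix_diff_rdistrib: "((A::real^'n::finite^'m) - B) ** C = A ** C - B ** C"
  by (simp add: matrix_matrix_mult_def vec_eq_iff sum_subtractf left_diff_distrib)

lemma transpose_diff: "transpose ((A::real^'n^'m) - B) = transpose A - transpose B"
  by (simp add: transpose_def vec_eq_iff)

lemma inner_transpose_mult_vec:
  fixes X :: "real^'p::finite^'n::finite"
  shows "x \<bullet> (transpose X *v y) = (X *v x) \<bullet> y"
  using dot_lmul_matrix[of y X x] by (simp add: inner_commute)

lemma symmetric_matrix_inner:
  fixes S :: "real^'n::finite^'n"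
  assumes "transpose S = S"
  shows "(S *v x) \<bullet> y = x \<bullet> (S *v y)"
  using inner_transpose_mult_vec[of y S x] assms by (simp add: inner_commute)

lemma mult_self_transpose_eq_0_iff:
  fixes E :: "real^'p::finite^'n::finite"
  shows "E ** transpose E = 0 \<longleftrightarrow> E = 0"
proof
  assume E: "E ** transpose E = 0"
  have "(\<Sum>k\<in>UNIV. E$i$k * E$i$k) = 0" for i
    using arg_cong[OF E, of "\<lambda>M. M$i$i"] by (simp add: matrix_matrix_mult_def transpose_def)
  then show "E = 0"
    by (simp add: vec_eq_iff sum_nonneg_eq_0_iff)
qed simp

lemma norm_add_scaleR_sq:
  fixes a b :: "'a::real_inner"
  shows "(norm (a + t *\<^sub>R b))\<^sup>2 = (norm a)\<^sup>2 + 2 * t * (a \<bullet> b) + t\<^sup>2 * (norm b)\<^sup>2"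
  by (simp only: power2_norm_eq_inner)
    (simp add: inner_add_left inner_add_right inner_commute algebra_simps power2_eq_square)

section \<open>Moore-Penrose pseudo-inverse\<close>

definition penrose :: "real^'m^'k \<Rightarrow> real^'k^'m \<Rightarrow> bool" where
  "penrose A B \<longleftrightarrow> A ** B ** A = A \<and> B ** A ** B = B \<and>
                    transpose (A ** B) = A ** B \<and> transpose (B ** A) = B ** A"

lemma penrose_unique:
  fixes A :: "real^'m::finite^'k::finite"
  assumes "penrose A B1" and "penrose A B2"
  shows "B1 = B2"
proof -
  have a1: "A ** B1 ** A = A" "B1 ** A ** B1 = B1"
      "transpose (A ** B1) = A ** B1" "transpose (B1 ** A) = B1 ** A"
    using assms(1) by (auto simp: penrose_def)
  have a2: "A ** B2 ** A = A" "B2 ** A ** B2 = B2"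
      "transpose (A ** B2) = A ** B2" "transpose (B2 ** A) = B2 ** A"
    using assms(2) by (auto simp: penrose_def)
  have transpose3: "transpose (X ** Y ** Z) = transpose Z ** transpose Y ** transpose X"
    for X :: "real^'m^'k" and Y :: "real^'k^'m" and Z :: "real^'m^'k"
    by (simp only: matrix_transpose_mul matrix_mul_assoc)
  have "B1 = B1 ** (A ** B1)" using a1(2) by (simp only: matrix_mul_assoc)
  also have "\<dots> = B1 ** transpose (A ** B1)" by (simp only: a1(3))
  also have "\<dots> = B1 ** (transpose B1 ** transpose A)" by (simp only: matrix_transpose_mul)
  also have "\<dots> = B1 ** (transpose B1 ** transpose (A ** B2 ** A))" by (simp only: a2(1))
  also have "\<dots> = B1 ** transpose (A ** B1) ** transpose (A ** B2)"
    by (simp only: matrix_transpose_mul matrix_mul_assoc)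
  also have "\<dots> = B1 ** A ** B1 ** (A ** B2)"
    by (simp only: a1(3) a2(3) matrix_mul_assoc)
  also have "\<dots> = B1 ** A ** B2" by (simp only: a1(2) matrix_mul_assoc)
  finally have B1_eq: "B1 = B1 ** A ** B2" .
  have "B2 = (B2 ** A) ** B2" using a2(2) by simp
  also have "\<dots> = transpose (B2 ** A) ** B2" by (simp only: a2(4))
  also have "\<dots> = transpose A ** transpose B2 ** B2" by (simp only: matrix_transpose_mul)
  also have "\<dots> = transpose (A ** B1 ** A) ** transpose B2 ** B2" by (simp only: a1(1))
  also have "\<dots> = transpose (B1 ** A) ** transpose (B2 ** A) ** B2"
    by (simp only: transpose3 matrix_transpose_mul matrix_mul_assoc)
  also have "\<dots> = B1 ** A ** (B2 ** A ** B2)"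
    by (simp only: a1(4) a2(4) matrix_mul_assoc)
  also have "\<dots> = B1 ** A ** B2" by (simp only: a2(2))
  finally show ?thesis using B1_eq by simp
qed

lemma orthogonal_projection_matrix_exists:
  fixes N :: "(real^'n::finite) set"
  assumes "subspace N"
  obtains Q :: "real^'n^'n"
  where "transpose Q = Q" "\<And>x. Q *v x \<in> N" "\<And>x. x \<in> N \<Longrightarrow> Q *v x = x"
proof -
  obtain Bs where Bs: "Bs \<subseteq> N" "pairwise orthogonal Bs" "\<And>x. x \<in> Bs \<Longrightarrow> norm x = 1"
      "independent Bs" "span Bs = N"
    using orthonormal_basis_subspace[OF assms] by metis
  have finB: "finite Bs" using Bs(4) by (simp add: independent_imp_finite)
  define Q :: "real^'n^'n" where "Q = (\<chi> i j. \<Sum>b\<in>Bs. b$i * b$j)"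
  have Qv: "Q *v x = (\<Sum>b\<in>Bs. (b \<bullet> x) *\<^sub>R b)" for x
    by (simp add: Q_def vec_eq_iff matrix_vector_mult_def inner_vec_def sum_distrib_left
        sum_distrib_right sum_component) (subst sum.swap, simp add: mult_ac)
  have "transpose Q = Q"
    by (simp add: Q_def transpose_def vec_eq_iff mult.commute)
  moreover have "Q *v x \<in> N" for x
    unfolding Qv using Bs(1) assms by (intro subspace_sum subspace_mul) auto
  moreover have "Q *v x = x" if xN: "x \<in> N" for x
  proof -
    obtain u where u: "(\<Sum>v\<in>Bs. u v *\<^sub>R v) = x"
      using xN Bs(5) span_finite[OF finB] by auto
    have "b \<bullet> x = u b" if bB: "b \<in> Bs" for b
    proof -
      have "b \<bullet> x = (\<Sum>v\<in>Bs. u v * (b \<bullet> v))"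
        unfolding u[symmetric] by (simp add: inner_sum_right)
      also have "\<dots> = (\<Sum>v\<in>Bs. if v = b then u b * (b \<bullet> b) else 0)"
        by (rule sum.cong)
          (use Bs(2) bB in \<open>auto simp: pairwise_def orthogonal_def inner_commute\<close>)
      also have "\<dots> = u b"
        using finB bB Bs(3)[OF bB] by (simp add: dot_square_norm)
      finally show ?thesis .
    qed
    then show ?thesis unfolding Qv u[symmetric] by (intro sum.cong) auto
  qed
  ultimately show ?thesis using that by blast
qed

lemma kernel_projection_symmetric:
  fixes A :: "real^'n::finite^'n"
  assumes symA: "transpose A = A"
  obtains Q :: "real^'n^'n" where "transpose Q = Q"
    "\<And>x. A *v (Q *v x) = 0" "\<And>x. Q *v (A *v x) = 0" "\<And>x. A *v x = 0 \<Longrightarrow> Q *v x = x"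
proof -
  have "subspace {x. A *v x = 0}"
    by (rule linear_subspace_kernel[OF matrix_vector_mul_linear])
  then obtain Q where Qsym: "transpose Q = Q" and QN: "\<And>x. Q *v x \<in> {x. A *v x = 0}"
      and Qfix: "\<And>x. x \<in> {x. A *v x = 0} \<Longrightarrow> Q *v x = x"
    using orthogonal_projection_matrix_exists by blast
  have "A ** Q = 0"
    using QN by (subst matrix_eq) (simp add: matrix_vector_mul_assoc[symmetric])
  moreover have "Q ** A = transpose (A ** Q)"
    by (simp add: matrix_transpose_mul Qsym symA)
  ultimately have "Q ** A = 0"
    by (simp add: transpose_def vec_eq_iff)
  then have "Q *v (A *v x) = 0" for x
    by (simp add: matrix_vector_mul_assoc)
  then show ?thesis
    using that Qsym QN Qfix by simp
qed

text \<open>With \<open>Q\<close> the orthogonal projection onto the kernel of a symmetric \<open>A\<close>, the matrix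
  \<open>A + Q\<close> is invertible and \<open>(A + Q)\<^sup>-\<^sup>1 - Q\<close> is the pseudo-inverse of \<open>A\<close>.\<close>

lemma penrose_exists_symmetric:
  fixes A :: "real^'n::finite^'n"
  assumes "transpose A = A"
  shows "\<exists>B. penrose A B"
proof -
  obtain Q where Qsym: "transpose Q = Q" and QN: "\<And>x. A *v (Q *v x) = 0"
      and vQA: "\<And>x. Q *v (A *v x) = 0" and Qfix: "\<And>x. A *v x = 0 \<Longrightarrow> Q *v x = x"
    using kernel_projection_symmetric[OF assms] by blast
  have vQQ: "Q *v (Q *v x) = Q *v x" for x using QN Qfix by blast
  define C where "C = A + Q"
  have vC: "C *v x = A *v x + Q *v x" for x by (simp add: C_def matrix_vector_mult_add_rdistrib)
  have "invertible C"
    unfolding invertible_iff_kernel_zero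
  proof (intro allI impI)
    fix x assume Cx: "C *v x = 0"
    have "Q *v x = Q *v (C *v x)"
      by (simp add: vC matrix_vector_right_distrib vQA vQQ)
    then have "Q *v x = 0"
      using Cx by simp
    moreover have "Q *v x = x"
      using Cx \<open>Q *v x = 0\<close> by (intro Qfix) (simp add: vC)
    ultimately show "x = 0" by simp
  qed
  define D where "D = matrix_inv C"
  have vCD: "C *v (D *v x) = x" and vDC: "D *v (C *v x) = x" for x
    using matrix_inv_inverse[OF \<open>invertible C\<close>]
    by (simp_all add: D_def matrix_vector_mul_assoc)
  have vCQ: "C *v (Q *v x) = Q *v x" for x by (simp add: vC QN vQQ)
  have vDQ: "D *v (Q *v x) = Q *v x" for x using vDC[of "Q *v x"] vCQ[of x] by simp
  have vQC: "Q *v (C *v x) = Q *v x" for x by (simp add: vC matrix_vector_right_distrib vQA vQQ)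
  have vQD: "Q *v (D *v x) = Q *v x" for x using vQC[of "D *v x"] vCD[of x] by simp
  have vA: "A *v x = C *v x - Q *v x" for x by (simp add: vC)
  define B where "B = D - Q"
  have AB: "A ** B = mat 1 - Q"
    by (subst matrix_eq) (auto simp: matrix_vector_mul_assoc[symmetric] B_def algebra_simps
        vA vCD vQD vQQ vCQ vDQ)
  have BA: "B ** A = mat 1 - Q"
    by (subst matrix_eq) (auto simp: matrix_vector_mul_assoc[symmetric] B_def algebra_simps
        vA vDC vQA vDQ vQC vCQ vQQ)
  have "transpose (mat 1 - Q) = mat 1 - Q"
    using Qsym by (simp add: transpose_diff)
  moreover have "A ** B ** A = A"
    unfolding AB by (subst matrix_eq) (auto simp: matrix_vector_mul_assoc[symmetric] algebra_simps vQA)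
  moreover have "B ** A ** B = B"
    unfolding BA by (subst matrix_eq) (auto simp: matrix_vector_mul_assoc[symmetric] B_def algebra_simps
        vQD vQQ vDQ)
  ultimately have "penrose A B"
    unfolding penrose_def AB BA by blast
  then show ?thesis ..
qed

lemma penrose_mp_pinv_symmetric:
  fixes A :: "real^'n::finite^'n"
  assumes "transpose A = A"
  shows "penrose A (mp_pinv A)"
proof -
  obtain B where B: "penrose A B"
    using penrose_exists_symmetric[OF assms] by blast
  have "mp_pinv A = B"
    unfolding mp_pinv_def
  proof (rule the_equality)
    fix B' assume "A ** B' ** A = A \<and> B' ** A ** B' = B' \<and>
        transpose (A ** B') = A ** B' \<and> transpose (B' ** A) = B' ** A"
    then show "B' = B"
      using penrose_unique[OF B] by (simp add: penrose_def)
  qed (use B in \<open>simp add: penrose_def\<close>)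
  then show ?thesis using B by simp
qed

lemma mult_proj_X:
  fixes X :: "real^'p::finite^'n::finite"
  shows "X ** proj_X X = X"
proof -
  define A where "A = X ** transpose X"
  define R where "R = A ** mp_pinv A"
  have symA: "transpose A = A" by (simp add: A_def matrix_transpose_mul)
  have ARA: "R ** A = A" and symR: "transpose R = R"
    using penrose_mp_pinv_symmetric[OF symA] by (auto simp: penrose_def R_def matrix_mul_assoc)
  have AR: "A ** R = A"
    using ARA matrix_transpose_mul[of R A] by (simp add: symA symR)
  define E where "E = X - R ** X"
  have "E ** transpose E = A - A ** R - R ** A + R ** A ** R"
    unfolding E_def transpose_diff matrix_transpose_mul symR
    by (simp add: matrix_diff_ldistrib matrix_diff_rdistrib matrix_mul_assoc A_def)
  also have "\<dots> = 0" by (simp add: ARA AR)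
  finally have "R ** X = X"
    by (simp add: mult_self_transpose_eq_0_iff E_def)
  then show ?thesis
    by (simp add: proj_X_def R_def A_def matrix_mul_assoc)
qed

section \<open>Smallest nonzero eigenvalue\<close>

lemma finite_nonzero_eigenvalues_symmetric:
  fixes S :: "real^'n::finite^'n"
  assumes symS: "transpose S = S"
  shows "finite {\<mu>. \<mu> \<noteq> 0 \<and> (\<exists>v. v \<noteq> 0 \<and> S *v v = \<mu> *\<^sub>R v)}" (is "finite ?E")
proof -
  define ev where "ev \<mu> = (SOME v. v \<noteq> 0 \<and> S *v v = \<mu> *\<^sub>R v)" for \<mu>
  have ev: "ev \<mu> \<noteq> 0 \<and> S *v ev \<mu> = \<mu> *\<^sub>R ev \<mu>" if "\<mu> \<in> ?E" for \<mu>
    unfolding ev_def by (rule someI_ex) (use that in auto)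
  have inj: "inj_on ev ?E"
  proof (rule inj_onI)
    fix a b assume a: "a \<in> ?E" and b: "b \<in> ?E" and eq: "ev a = ev b"
    have "a *\<^sub>R ev a = b *\<^sub>R ev a" using ev[OF a] ev[OF b] eq by metis
    then show "a = b" using ev[OF a] by (simp add: scaleR_cancel_right)
  qed
  have "pairwise orthogonal (ev ` ?E)"
    unfolding pairwise_def orthogonal_def
  proof (intro ballI impI)
    fix x y assume "x \<in> ev ` ?E" "y \<in> ev ` ?E" "x \<noteq> y"
    then obtain a b where a: "a \<in> ?E" and b: "b \<in> ?E" and "a \<noteq> b"
        and xy: "x = ev a" "y = ev b"
      by blast
    have "a * (ev a \<bullet> ev b) = (S *v ev a) \<bullet> ev b" using ev[OF a] by simp
    also have "\<dots> = ev a \<bullet> (S *v ev b)" by (rule symmetric_matrix_inner[OF symS])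
    also have "\<dots> = b * (ev a \<bullet> ev b)" using ev[OF b] by simp
    finally show "x \<bullet> y = 0" using \<open>a \<noteq> b\<close> xy by (metis mult_right_cancel)
  qed
  moreover have "0 \<notin> ev ` ?E" using ev by fastforce
  ultimately have "finite (ev ` ?E)"
    using pairwise_orthogonal_independent independent_imp_finite by blast
  then show ?thesis using inj finite_imageD by blast
qed

lemma linear_coeff_eq_0_if_quadratic_nonneg:
  fixes c d :: real
  assumes "\<And>t. 0 \<le> 2 * t * c + t\<^sup>2 * d"
  shows "c = 0"
proof (rule ccontr)
  assume "c \<noteq> 0"
  define k where "k = \<bar>d\<bar> + 1"
  have k: "k \<ge> 1" by (simp add: k_def)
  have "0 \<le> 2 * (-c/k) * c + (-c/k)\<^sup>2 * d" by (rule assms)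
  then have "0 \<le> (2 * (-c) * c * k + c\<^sup>2 * d) / k\<^sup>2"
    using k by (simp add: field_simps power2_eq_square)
  then have "0 \<le> 2 * (-c) * c * k + c\<^sup>2 * d"
    using k by (simp add: zero_le_divide_iff)
  moreover have "c\<^sup>2 * d \<le> c\<^sup>2 * \<bar>d\<bar>" by (simp add: mult_left_mono)
  moreover have "c\<^sup>2 > 0" using \<open>c \<noteq> 0\<close> by simp
  moreover have "2 * (-c) * c * k = -2 * c\<^sup>2 - 2 * (c\<^sup>2 * \<bar>d\<bar>)"
    by (simp add: k_def algebra_simps power2_eq_square)
  ultimately show False by (smt (verit) zero_le_mult_iff abs_ge_zero)
qed

lemma norm_mult_vec_attains_min_on_subspace:
  fixes S :: "real^'n::finite^'n"
  assumes subV: "subspace V" and "v0 \<in> V" "v0 \<noteq> 0"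
  obtains w0 where "w0 \<in> V" "norm w0 = 1"
    "\<And>u. u \<in> V \<Longrightarrow> (norm (S *v w0))\<^sup>2 * (norm u)\<^sup>2 \<le> (norm (S *v u))\<^sup>2"
proof -
  define K where "K = V \<inter> sphere 0 1"
  have "compact K" unfolding K_def
    by (rule closed_Int_compact) (auto intro: closed_subspace subV)
  moreover have "v0 /\<^sub>R norm v0 \<in> K" using assms by (auto simp: K_def subspace_scale)
  moreover have "continuous_on K (\<lambda>w. (norm (S *v w))\<^sup>2)"
    by (intro continuous_intros linear_continuous_on) auto
  ultimately obtain w0 where w0K: "w0 \<in> K"
      and w0_min: "\<And>y. y \<in> K \<Longrightarrow> (norm (S *v w0))\<^sup>2 \<le> (norm (S *v y))\<^sup>2"
    using continuous_attains_inf[of K] by blast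
  have "(norm (S *v w0))\<^sup>2 * (norm u)\<^sup>2 \<le> (norm (S *v u))\<^sup>2" if "u \<in> V" for u
  proof (cases "u = 0")
    case False
    then have "u /\<^sub>R norm u \<in> K" using that subV by (auto simp: K_def subspace_scale)
    then have "(norm (S *v w0))\<^sup>2 \<le> (norm (S *v (u /\<^sub>R norm u)))\<^sup>2" by (rule w0_min)
    also have "\<dots> = (norm (S *v u))\<^sup>2 / (norm u)\<^sup>2"
      by (simp add: matrix_vector_mult_scaleR power_divide divide_inverse power_inverse power_mult_distrib)
    finally show ?thesis using False by (simp add: field_simps)
  qed simp
  then show ?thesis using that w0K by (auto simp: K_def)
qed

text \<open>A minimiser of \<open>\<parallel>S w\<parallel>\<^sup>2\<close> on the unit sphere of an \<open>S\<close>-invariant subspace is an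
  eigenvector of \<open>S\<^sup>2\<close>: the first variation in every direction \<open>v \<in> V\<close> vanishes.\<close>

lemma min_norm_mult_vec_eigenvector:
  fixes S :: "real^'n::finite^'n"
  assumes symS: "transpose S = S" and subV: "subspace V"
    and inv: "\<And>w. w \<in> V \<Longrightarrow> S *v w \<in> V"
    and w0: "w0 \<in> V" "norm w0 = 1"
    and min: "\<And>u. u \<in> V \<Longrightarrow> (norm (S *v w0))\<^sup>2 * (norm u)\<^sup>2 \<le> (norm (S *v u))\<^sup>2"
  shows "S *v (S *v w0) = (norm (S *v w0))\<^sup>2 *\<^sub>R w0"
proof -
  define m where "m = (norm (S *v w0))\<^sup>2"
  have var: "(S *v (S *v w0) - m *\<^sub>R w0) \<bullet> v = 0" if vV: "v \<in> V" for v
  proof -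
    define c where "c = (S *v w0) \<bullet> (S *v v) - m * (w0 \<bullet> v)"
    define d where "d = (norm (S *v v))\<^sup>2 - m * (norm v)\<^sup>2"
    have "0 \<le> 2 * t * c + t\<^sup>2 * d" for t
    proof -
      have "w0 + t *\<^sub>R v \<in> V" using w0 vV subV by (simp add: subspace_add subspace_scale)
      from min[OF this]
      have "m * (norm (w0 + t *\<^sub>R v))\<^sup>2 \<le> (norm (S *v w0 + t *\<^sub>R (S *v v)))\<^sup>2"
        by (simp add: m_def algebra_simps)
      then show ?thesis
        using w0(2) by (simp add: norm_add_scaleR_sq c_def d_def m_def algebra_simps)
    qed
    then have "c = 0" by (rule linear_coeff_eq_0_if_quadratic_nonneg)
    then show ?thesis
      by (simp add: c_def inner_diff_left symmetric_matrix_inner[OF symS])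
  qed
  have "S *v (S *v w0) - m *\<^sub>R w0 \<in> V"
    using inv w0 subV by (simp add: subspace_diff subspace_scale)
  from var[OF this] show ?thesis by (simp add: m_def)
qed

lemma positive_eigenvalue_lower_bound:
  fixes S :: "real^'n::finite^'n"
  assumes symS: "transpose S = S" and psd: "\<And>x. 0 \<le> x \<bullet> (S *v x)"
    and subV: "subspace V" and inv: "\<And>w. w \<in> V \<Longrightarrow> S *v w \<in> V"
    and injV: "\<And>w. w \<in> V \<Longrightarrow> S *v w = 0 \<Longrightarrow> w = 0"
    and "v0 \<in> V" "v0 \<noteq> 0"
  obtains s v where "s > 0" "v \<noteq> 0" "S *v v = s *\<^sub>R v"
    "\<And>w. w \<in> V \<Longrightarrow> s * norm w \<le> norm (S *v w)"
proof -
  obtain w0 where w0: "w0 \<in> V" "norm w0 = 1"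
    and min: "\<And>u. u \<in> V \<Longrightarrow> (norm (S *v w0))\<^sup>2 * (norm u)\<^sup>2 \<le> (norm (S *v u))\<^sup>2"
    using norm_mult_vec_attains_min_on_subspace[OF subV \<open>v0 \<in> V\<close> \<open>v0 \<noteq> 0\<close>] by blast
  define s where "s = norm (S *v w0)"
  have "s > 0" using injV[OF w0(1)] w0(2) by (auto simp: s_def)
  have SSw0: "S *v (S *v w0) = (s * s) *\<^sub>R w0"
    using min_norm_mult_vec_eigenvector[OF symS subV inv w0 min] by (simp add: s_def power2_eq_square)
  text \<open>The square root \<open>s\<close> of the eigenvalue \<open>s\<^sup>2\<close> of \<open>S\<^sup>2\<close> is an eigenvalue of \<open>S\<close>,
    with eigenvector \<open>S w\<^sub>0 + s w\<^sub>0\<close>; positivity of \<open>S\<close> rules out that this vector is zero.\<close>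
  define v where "v = S *v w0 + s *\<^sub>R w0"
  have "v \<noteq> 0"
  proof
    assume "v = 0"
    then have "w0 \<bullet> (S *v w0) = - s * (w0 \<bullet> w0)"
      by (simp add: v_def eq_neg_iff_add_eq_0[symmetric])
    then show False
      using psd[of w0] \<open>s > 0\<close> w0(2) by (simp add: dot_square_norm)
  qed
  moreover have "S *v v = s *\<^sub>R v"
    by (simp add: v_def algebra_simps SSw0 matrix_vector_mult_scaleR)
  moreover have "s * norm w \<le> norm (S *v w)" if "w \<in> V" for w
    using min[OF that] \<open>s > 0\<close>
    by (simp add: s_def power_mult_distrib[symmetric] power2_le_iff_abs_le)
  ultimately show ?thesis using that \<open>s > 0\<close> by blast
qed

lemma min_nonzero_eig_lower_bound:
  fixes S :: "real^'n::finite^'n"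
  assumes symS: "transpose S = S" and psd: "\<And>x. 0 \<le> x \<bullet> (S *v x)"
    and subV: "subspace V" and inv: "\<And>w. w \<in> V \<Longrightarrow> S *v w \<in> V"
    and injV: "\<And>w. w \<in> V \<Longrightarrow> S *v w = 0 \<Longrightarrow> w = 0"
    and "v0 \<in> V" "v0 \<noteq> 0"
  shows "min_nonzero_eig S > 0"
    and "\<And>w. w \<in> V \<Longrightarrow> min_nonzero_eig S * norm w \<le> norm (S *v w)"
proof -
  define E where "E = {\<mu>. \<mu> \<noteq> 0 \<and> (\<exists>v. v \<noteq> 0 \<and> S *v v = \<mu> *\<^sub>R v)}"
  have "finite E"
    unfolding E_def by (rule finite_nonzero_eigenvalues_symmetric[OF symS])
  obtain s v where "s > 0" "v \<noteq> 0" "S *v v = s *\<^sub>R v"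
      and s_bound: "\<And>w. w \<in> V \<Longrightarrow> s * norm w \<le> norm (S *v w)"
    using positive_eigenvalue_lower_bound[OF assms] by blast
  then have "s \<in> E" by (auto simp: E_def)
  have mu: "min_nonzero_eig S = Min E"
    by (simp add: min_nonzero_eig_def E_def)
  have "Min E \<in> E" using \<open>finite E\<close> \<open>s \<in> E\<close> by (intro Min_in) auto
  then obtain u where u: "u \<noteq> 0" "S *v u = Min E *\<^sub>R u" "Min E \<noteq> 0"
    by (auto simp: E_def)
  have "0 \<le> Min E * (u \<bullet> u)"
    using psd[of u] u(2) by simp
  moreover have "u \<bullet> u > 0" using u(1) by simp
  ultimately show "min_nonzero_eig S > 0"
    using u(3) by (simp add: mu zero_le_mult_iff)
  have "Min E \<le> s" using \<open>finite E\<close> \<open>s \<in> E\<close> by simp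
  then show "min_nonzero_eig S * norm w \<le> norm (S *v w)" if "w \<in> V" for w
    using s_bound[OF that] unfolding mu by (meson mult_right_mono norm_ge_zero order_trans)
qed

section \<open>Bias of the ridge estimator\<close>

lemma Sigma_hat_mult_vec:
  fixes X :: "real^'p::finite^'n::finite"
  shows "Sigma_hat X *v x = transpose X *v (inverse (real CARD('n)) *\<^sub>R (X *v x))"
  by (simp add: Sigma_hat_def scaleR_matrix_vector_assoc[symmetric]
      matrix_vector_mul_assoc[symmetric] matrix_vector_mult_scaleR)

lemma symmetric_Sigma_hat:
  fixes X :: "real^'p::finite^'n::finite"
  shows "transpose (Sigma_hat X) = Sigma_hat X"
  by (simp add: Sigma_hat_def transpose_scalar matrix_transpose_mul)

lemma inner_Sigma_hat:
  fixes X :: "real^'p::finite^'n::finite"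
  shows "x \<bullet> (Sigma_hat X *v x) = inverse (real CARD('n)) * (norm (X *v x))\<^sup>2"
  by (simp only: Sigma_hat_mult_vec inner_transpose_mult_vec) (simp add: power2_norm_eq_inner)

lemma invertible_psd_plus_scaleR:
  fixes S :: "real^'n::finite^'n"
  assumes psd: "\<And>x. 0 \<le> x \<bullet> (S *v x)" and "lam > 0"
  shows "invertible (S + lam *\<^sub>R mat 1)"
  unfolding invertible_iff_kernel_zero
proof (intro allI impI)
  fix x assume "(S + lam *\<^sub>R mat 1) *v x = 0"
  then have "S *v x + lam *\<^sub>R x = 0"
    by (simp add: matrix_vector_mult_add_rdistrib scaleR_matrix_vector_assoc[symmetric])
  then have "x \<bullet> (S *v x + lam *\<^sub>R x) = 0" by simp
  then have "x \<bullet> (S *v x) + lam * (x \<bullet> x) = 0" by (simp add: inner_add_right)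
  then have "lam * (x \<bullet> x) = 0"
    using psd[of x] \<open>lam > 0\<close> by (smt (verit) inner_ge_zero mult_nonneg_nonneg)
  then show "x = 0" using \<open>lam > 0\<close> by simp
qed

lemma
  fixes S :: "real^'n::finite^'n"
  assumes psd: "\<And>x. 0 \<le> x \<bullet> (S *v x)" and "lam > 0"
  defines "R \<equiv> matrix_inv (S + lam *\<^sub>R mat 1)"
  shows mult_resolvent_add: "S *v (R *v y) + lam *\<^sub>R (R *v y) = y"
    and resolvent_mult_add: "R *v (S *v y) + lam *\<^sub>R (R *v y) = y"
proof -
  note inv = matrix_inv_inverse[OF invertible_psd_plus_scaleR[OF psd \<open>lam > 0\<close>]]
  have "(S + lam *\<^sub>R mat 1) *v (R *v y) = y" and "R *v ((S + lam *\<^sub>R mat 1) *v y) = y"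
    using inv by (simp_all add: R_def matrix_vector_mul_assoc)
  then show "S *v (R *v y) + lam *\<^sub>R (R *v y) = y" and "R *v (S *v y) + lam *\<^sub>R (R *v y) = y"
    by (simp_all add: matrix_vector_mult_add_rdistrib matrix_vector_right_distrib
        matrix_vector_mult_scaleR scaleR_matrix_vector_assoc[symmetric])
qed

lemma norm_mult_resolvent_le:
  fixes S :: "real^'n::finite^'n"
  assumes psd: "\<And>x. 0 \<le> x \<bullet> (S *v x)" and "lam > 0"
  shows "norm (S *v (matrix_inv (S + lam *\<^sub>R mat 1) *v y)) \<le> norm y"
proof -
  define w where "w = matrix_inv (S + lam *\<^sub>R mat 1) *v y"
  have "(norm y)\<^sup>2 = (norm (S *v w))\<^sup>2 + 2 * lam * ((S *v w) \<bullet> w) + lam\<^sup>2 * (norm w)\<^sup>2"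
    using norm_add_scaleR_sq[of "S *v w" lam w] mult_resolvent_add[OF assms, of y] by (simp add: w_def)
  moreover have "(S *v w) \<bullet> w \<ge> 0" using psd[of w] by (simp add: inner_commute)
  ultimately have "(norm (S *v w))\<^sup>2 \<le> (norm y)\<^sup>2"
    using \<open>lam > 0\<close> by (smt (verit) mult_nonneg_nonneg zero_le_power2)
  then show ?thesis by (simp add: w_def power2_le_iff_abs_le)
qed

lemma min_nonzero_eig_Sigma_hat:
  fixes X :: "real^'p::finite^'n::finite"
  assumes "X \<noteq> 0"
  shows "min_nonzero_eig (Sigma_hat X) > 0"
    and "\<And>w. w \<in> range ((*v) (transpose X)) \<Longrightarrow>
           min_nonzero_eig (Sigma_hat X) * norm w \<le> norm (Sigma_hat X *v w)"
proof -
  let ?V = "range ((*v) (transpose X))"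
  have psd: "0 \<le> x \<bullet> (Sigma_hat X *v x)" for x
    by (simp add: inner_Sigma_hat)
  have subV: "subspace ?V"
    by (rule linear_subspace_image[OF matrix_vector_mul_linear subspace_UNIV])
  have inv: "Sigma_hat X *v w \<in> ?V" for w
    by (simp add: Sigma_hat_mult_vec)
  have inj: "w = 0" if wV: "w \<in> ?V" and Sw: "Sigma_hat X *v w = 0" for w
  proof -
    obtain y where y: "w = transpose X *v y" using wV by blast
    have "X *v w = 0" using inner_Sigma_hat[of w X] Sw by simp
    moreover have "w \<bullet> w = (X *v w) \<bullet> y"
      using inner_transpose_mult_vec[of w X y] by (simp only: y[symmetric])
    ultimately have "w \<bullet> w = 0" by simp
    then show ?thesis by simp
  qed
  have "\<exists>y. transpose X *v y \<noteq> 0"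
  proof (rule ccontr)
    assume "\<nexists>y. transpose X *v y \<noteq> 0"
    then have "transpose X = 0" by (subst matrix_eq) simp
    then show False
      using assms by (metis transpose_transpose transpose_scalar scale_zero_left)
  qed
  then obtain y where "transpose X *v y \<noteq> 0" by blast
  note bound = min_nonzero_eig_lower_bound[OF symmetric_Sigma_hat psd subV inv inj
      rangeI[of _ y] this]
  show "min_nonzero_eig (Sigma_hat X) > 0" using bound(1) by simp
  show "\<And>w. w \<in> ?V \<Longrightarrow> min_nonzero_eig (Sigma_hat X) * norm w \<le> norm (Sigma_hat X *v w)"
    using bound(2) by simp
qed

lemma norm_ridge_bias_le:
  fixes X :: "real^'p::finite^'n::finite"
  assumes "lam > 0" and "X \<noteq> 0"
  shows "norm (matrix_inv (Sigma_hat X + lam *\<^sub>R mat 1) *v (Sigma_hat X *v beta) - proj_X X *v beta)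
       \<le> lam * norm (proj_X X *v beta) / min_nonzero_eig (Sigma_hat X)"
proof -
  define S where "S = Sigma_hat X"
  define R where "R = matrix_inv (S + lam *\<^sub>R mat 1)"
  define \<theta> where "\<theta> = proj_X X *v beta"
  define w where "w = R *v \<theta>"
  let ?V = "range ((*v) (transpose X))"
  have psd: "0 \<le> x \<bullet> (S *v x)" for x
    by (simp add: S_def inner_Sigma_hat)
  have "X *v \<theta> = X *v beta"
    using mult_proj_X[of X] by (simp add: \<theta>_def matrix_vector_mul_assoc)
  then have "S *v \<theta> = S *v beta"
    by (simp add: S_def Sigma_hat_mult_vec)
  then have bias: "R *v (S *v beta) - \<theta> = - lam *\<^sub>R w"
    using resolvent_mult_add[OF psd \<open>lam > 0\<close>, of \<theta>] by (simp add: R_def w_def algebra_simps)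
  have "w \<in> ?V"
  proof -
    have "lam *\<^sub>R w = \<theta> - S *v w"
      using mult_resolvent_add[OF psd \<open>lam > 0\<close>, of \<theta>] by (simp add: R_def w_def eq_diff_eq add.commute)
    then have "inverse lam *\<^sub>R (lam *\<^sub>R w) = inverse lam *\<^sub>R (\<theta> - S *v w)" by simp
    then have "w = inverse lam *\<^sub>R (\<theta> - S *v w)" using \<open>lam > 0\<close> by simp
    moreover have "\<theta> \<in> ?V" "S *v w \<in> ?V"
      by (simp_all add: \<theta>_def proj_X_def matrix_vector_mul_assoc[symmetric] S_def Sigma_hat_mult_vec)
    ultimately show ?thesis
      using linear_subspace_image[OF matrix_vector_mul_linear subspace_UNIV, of "transpose X"]
      by (metis subspace_diff subspace_scale)
  qed
  then have "min_nonzero_eig S * norm w \<le> norm (S *v w)"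
    unfolding S_def by (rule min_nonzero_eig_Sigma_hat(2)[OF \<open>X \<noteq> 0\<close>])
  also have "\<dots> \<le> norm \<theta>"
    unfolding w_def R_def by (rule norm_mult_resolvent_le[OF psd \<open>lam > 0\<close>])
  finally have "norm w \<le> norm \<theta> / min_nonzero_eig S"
    using min_nonzero_eig_Sigma_hat(1)[OF \<open>X \<noteq> 0\<close>] by (simp add: S_def field_simps)
  then have "lam * norm w \<le> lam * (norm \<theta> / min_nonzero_eig S)"
    using \<open>lam > 0\<close> by (intro mult_left_mono) auto
  then show ?thesis
    using \<open>lam > 0\<close> bias by (simp add: R_def S_def \<theta>_def)
qed

lemma nonzero_if_Omega_min_pos:
  fixes X :: "real^'p::finite^'n::finite"
  assumes "Omega_min X lam > 0"
  shows "X \<noteq> 0"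
proof
  assume "X = 0"
  then have "Omega X lam = 0" by (simp add: Omega_def Sigma_hat_def)
  then show False using assms by (simp add: Omega_min_def)
qed

lemma
  fixes X :: "real^'p::finite^'n::finite"
  assumes "\<sigma> > 0" and "Omega_min X lam > 0"
  shows a_coef_nonneg: "0 \<le> a_coef X lam \<sigma> j"
    and a_coef_le: "a_coef X lam \<sigma> j \<le> sqrt (real CARD('n)) / \<sigma> / sqrt (Omega_min X lam)"
proof -
  have "Omega_min X lam \<le> Omega X lam $ j $ j"
    unfolding Omega_min_def by (rule Min_le) auto
  then show "0 \<le> a_coef X lam \<sigma> j" "a_coef X lam \<sigma> j \<le> sqrt (real CARD('n)) / \<sigma> / sqrt (Omega_min X lam)"
    unfolding a_coef_def using assms by (auto intro: divide_left_mono divide_nonneg_pos)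
qed

lemma scaled_ridge_bias_le:
  fixes X :: "real^'p::finite^'n::finite"
  assumes "\<sigma> > 0" and "lam > 0" and "Omega_min X lam > 0"
  shows "a_coef X lam \<sigma> j
           * \<bar>(matrix_inv (Sigma_hat X + lam *\<^sub>R mat 1) *v (Sigma_hat X *v beta) - proj_X X *v beta) $ j\<bar>
       \<le> lam / sqrt (Omega_min X lam) * sqrt (real CARD('n)) / \<sigma> * norm (proj_X X *v beta)
           * inverse (min_nonzero_eig (Sigma_hat X))"
proof -
  let ?v = "matrix_inv (Sigma_hat X + lam *\<^sub>R mat 1) *v (Sigma_hat X *v beta) - proj_X X *v beta"
  have "\<bar>?v $ j\<bar> \<le> lam * norm (proj_X X *v beta) / min_nonzero_eig (Sigma_hat X)"
    using component_le_norm_cart[of ?v j]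
      norm_ridge_bias_le[OF \<open>lam > 0\<close> nonzero_if_Omega_min_pos[OF assms(3)], of beta]
    by (rule order_trans)
  then have "a_coef X lam \<sigma> j * \<bar>?v $ j\<bar>
      \<le> sqrt (real CARD('n)) / \<sigma> / sqrt (Omega_min X lam)
          * (lam * norm (proj_X X *v beta) / min_nonzero_eig (Sigma_hat X))"
    using a_coef_le[OF \<open>\<sigma> > 0\<close> assms(3)] a_coef_nonneg[OF \<open>\<sigma> > 0\<close> assms(3)] assms
    by (intro mult_mono) auto
  then show ?thesis by (simp add: field_simps)
qed

lemma ridge_affine:
  fixes X :: "real^'p::finite^'n::finite"
  shows "ridge X lam (X *v beta + e) =
     matrix_inv (Sigma_hat X + lam *\<^sub>R mat 1) *v (Sigma_hat X *v beta)
     + (matrix_inv (Sigma_hat X + lam *\<^sub>R mat 1) ** (inverse (real CARD('n)) *\<^sub>R transpose X)) *v e"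
  by (simp add: ridge_def Sigma_hat_def matrix_vector_right_distrib matrix_vector_mult_scaleR
      scaleR_matrix_vector_assoc[symmetric] matrix_vector_mul_assoc[symmetric] scaleR_right_distrib)

lemma integral_ridge_gauss_noise:
  fixes X :: "real^'p::finite^'n::finite"
  assumes "\<sigma> > 0"
  shows "(\<integral>e. ridge X lam (X *v beta + e) $ j \<partial>gauss_noise \<sigma>)
       = (matrix_inv (Sigma_hat X + lam *\<^sub>R mat 1) *v (Sigma_hat X *v beta)) $ j"
  unfolding ridge_affine by (rule integral_gauss_noise_affine[OF assms])

lemma borel_measurable_ridge [measurable]:
  fixes X :: "real^'p::finite^'n::finite"
  shows "ridge X lam \<in> borel_measurable borel"
proof -
  have "ridge X lam = (*v) (matrix_inv (Sigma_hat X + lam *\<^sub>R mat 1)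
                            ** (inverse (real CARD('n)) *\<^sub>R transpose X))"
    by (simp only: fun_eq_iff ridge_def scaleR_matrix_vector_assoc matrix_vector_mul_assoc) simp
  then show ?thesis
    by (simp add: borel_measurable_continuous_onI matrix_vector_mult_linear_continuous_on)
qed

section \<open>The corrected estimator\<close>

lemma corrected_estimator_le:
  fixes P :: "real^'p::finite^'p" and a \<Delta> B :: real
  assumes "0 \<le> a" and "beta $ j = 0"
    and "\<bar>a * (\<Sum>k\<in>UNIV-{j}. P $ j $ k * (y $ k - beta $ k))\<bar> \<le> \<Delta>"
    and "a * \<bar>m - (P *v beta) $ j\<bar> \<le> B"
  shows "a * \<bar>x - (\<Sum>k\<in>UNIV-{j}. P $ j $ k * y $ k)\<bar> \<le> a * \<bar>x - m\<bar> + \<Delta> + B"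
proof -
  let ?d = "\<Sum>k\<in>UNIV-{j}. P $ j $ k * (y $ k - beta $ k)"
  have "x - (\<Sum>k\<in>UNIV-{j}. P $ j $ k * y $ k) = (x - m) + (m - (P *v beta) $ j) - ?d"
    using assms(2)
    by (simp add: matrix_vector_mult_def sum.remove[of UNIV j] sum_subtractf right_diff_distrib)
  also have "a * \<bar>\<dots>\<bar> \<le> a * (\<bar>x - m\<bar> + \<bar>m - (P *v beta) $ j\<bar> + \<bar>?d\<bar>)"
    using assms(1) by (intro mult_left_mono) auto
  finally show ?thesis
    using assms(1,3,4) by (simp add: abs_mult distrib_left)
qed

lemma pointwise_le_absorbs_group_max_le:
  fixes f g :: "'p::finite \<Rightarrow> real"
  shows "((\<forall>j. S j \<longrightarrow> f j \<le> g j + c)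
          \<and> (\<forall>G. G \<noteq> {} \<and> (\<forall>j\<in>G. S j) \<longrightarrow> Max (f ` G) \<le> Max (g ` G) + c))
       \<longleftrightarrow> (\<forall>j. S j \<longrightarrow> f j \<le> g j + c)"
proof -
  have "Max (f ` G) \<le> Max (g ` G) + c"
    if pointwise: "\<forall>j. S j \<longrightarrow> f j \<le> g j + c" and G: "G \<noteq> {}" "\<forall>j\<in>G. S j" for G
  proof -
    have "f j \<le> Max (g ` G) + c" if "j \<in> G" for j
      using pointwise G that Max_ge[of "g ` G" "g j"] by fastforce
    then show ?thesis using G by simp
  qed
  then show ?thesis by blast
qed

lemma sets_borel_corrected_bound:
  fixes bhat init :: "real^'n::finite \<Rightarrow> real^'p::finite"
  assumes "bhat \<in> borel_measurable borel" "init \<in> borel_measurable borel"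
  shows "{e. \<forall>j. beta $ j = 0 \<longrightarrow> a j * \<bar>bhat e $ j - (\<Sum>k\<in>UNIV-{j}. P $ j $ k * init e $ k)\<bar>
               \<le> a j * \<bar>bhat e $ j - m j\<bar> + \<Delta> j + c} \<in> sets borel"
proof -
  have [measurable]: "(\<lambda>e. bhat e $ j) \<in> borel_measurable borel" "(\<lambda>e. init e $ j) \<in> borel_measurable borel"
    for j using assms by (auto intro: measurable_compose[OF _ borel_measurable_nth])
  have "{e. \<forall>j. beta $ j = 0 \<longrightarrow> a j * \<bar>bhat e $ j - (\<Sum>k\<in>UNIV-{j}. P $ j $ k * init e $ k)\<bar>
               \<le> a j * \<bar>bhat e $ j - m j\<bar> + \<Delta> j + c}
      = {e \<in> space borel. \<forall>j. beta $ j = 0 \<longrightarrow> a j * \<bar>bhat e $ j - (\<Sum>k\<in>UNIV-{j}. P $ j $ k * init e $ k)\<bar>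
               \<le> a j * \<bar>bhat e $ j - m j\<bar> + \<Delta> j + c}"
    by simp
  also have "\<dots> \<in> sets borel" by measurable
  finally show ?thesis .
qed

theorem proposition3:
  fixes X :: "real^'p^'n" and beta0 :: "real^'p" and \<sigma> lam \<kappa> :: real
    and beta_init :: "real^'n \<Rightarrow> real^'p" and \<Delta> :: "'p \<Rightarrow> real"
  defines "M \<equiv> gauss_noise \<sigma> :: (real^'n) measure"
  defines "Y \<equiv> (\<lambda>e. X *v beta0 + e)"
  defines "P \<equiv> proj_X X"
  defines "theta0 \<equiv> P *v beta0"
  defines "a \<equiv> a_coef X lam \<sigma>"
  defines "bhat \<equiv> (\<lambda>e. ridge X lam (Y e))"
  defines "b \<equiv> (\<lambda>j. (\<integral>e. bhat e $ j \<partial>M) - theta0 $ j)"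
  defines "Z \<equiv> (\<lambda>e j. bhat e $ j - (\<integral>e'. bhat e' $ j \<partial>M))"
  defines "bcorr \<equiv> (\<lambda>e j. bhat e $ j - (\<Sum>k\<in>UNIV-{j}. P $ j $ k * beta_init (Y e) $ k))"
  defines "ab_inf \<equiv> Max (range (\<lambda>j. a j * \<bar>b j\<bar>))"
  assumes sigma_pos: "\<sigma> > 0"
    and lam_pos: "lam > 0"
    and Omin_pos: "Omega_min X lam > 0"
    and init_meas: "beta_init \<in> borel_measurable borel"
    and Delta_pos: "\<forall>j. \<Delta> j > 0"
    and kappa: "0 < \<kappa>" "\<kappa> < 1"
    and A': "measure M {e. \<forall>j. \<bar>a j * (\<Sum>k\<in>UNIV-{j}. P $ j $ k * (beta_init (Y e) $ k - beta0 $ k))\<bar>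
                                  \<le> \<Delta> j} \<ge> 1 - \<kappa>"
  shows "ab_inf \<le> lam / sqrt (Omega_min X lam) * sqrt (real CARD('n)) / \<sigma> * norm theta0
                    * inverse (min_nonzero_eig (Sigma_hat X))
       \<and> measure M {e.
            (\<forall>j. beta0 $ j = 0 \<longrightarrow> a j * \<bar>bcorr e j\<bar> \<le> a j * \<bar>Z e j\<bar> + \<Delta> j + ab_inf)
          \<and> (\<forall>G. G \<noteq> {} \<and> (\<forall>j\<in>G. beta0 $ j = 0) \<longrightarrow>
                 Max ((\<lambda>j. a j * \<bar>bcorr e j\<bar>) ` G)
                   \<le> Max ((\<lambda>j. a j * \<bar>Z e j\<bar> + \<Delta> j) ` G) + ab_inf)} \<ge> 1 - \<kappa>"
proof -
  interpret prob_space M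
    unfolding M_def by (rule prob_space_gauss_noise[OF sigma_pos])
  let ?bound = "lam / sqrt (Omega_min X lam) * sqrt (real CARD('n)) / \<sigma> * norm theta0
                 * inverse (min_nonzero_eig (Sigma_hat X))"
  have b_eq: "b j = (matrix_inv (Sigma_hat X + lam *\<^sub>R mat 1) *v (Sigma_hat X *v beta0) - theta0) $ j" for j
    using integral_ridge_gauss_noise[OF sigma_pos] by (simp add: b_def bhat_def Y_def M_def)
  have bias_le: "a j * \<bar>b j\<bar> \<le> ?bound" for j
    using scaled_ridge_bias_le[OF sigma_pos lam_pos Omin_pos] by (simp add: a_def b_eq theta0_def P_def)
  define err where "err e j = (\<Sum>k\<in>UNIV-{j}. P $ j $ k * (beta_init (Y e) $ k - beta0 $ k))" for e j
  let ?E = "{e. \<forall>j. beta0 $ j = 0 \<longrightarrow> a j * \<bar>bcorr e j\<bar> \<le> a j * \<bar>Z e j\<bar> + \<Delta> j + ab_inf}"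
  have "a j * \<bar>b j\<bar> \<le> ab_inf" for j
    unfolding ab_inf_def by (rule Max_ge) auto
  then have "{e. \<forall>j. \<bar>a j * err e j\<bar> \<le> \<Delta> j} \<subseteq> ?E"
    by (auto simp: a_def err_def bcorr_def Z_def b_def theta0_def
        intro!: corrected_estimator_le[OF a_coef_nonneg[OF sigma_pos Omin_pos]])
  moreover have "?E \<in> sets M"
  proof -
    have "Y \<in> borel_measurable borel"
      unfolding Y_def by (intro borel_measurable_continuous_onI continuous_intros)
    then show ?thesis
      unfolding M_def sets_gauss_noise bcorr_def Z_def bhat_def
      by (intro sets_borel_corrected_bound measurable_compose[OF _ borel_measurable_ridge]
          measurable_compose[OF _ init_meas])
  qed
  ultimately have "measure M {e. \<forall>j. \<bar>a j * err e j\<bar> \<le> \<Delta> j} \<le> measure M ?E"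
    by (rule finite_measure_mono)
  then have "1 - \<kappa> \<le> measure M ?E"
    using A' unfolding err_def by linarith
  moreover have "ab_inf \<le> ?bound"
    using bias_le by (simp add: ab_inf_def)
  ultimately show ?thesis
    unfolding pointwise_le_absorbs_group_max_le by simp
qed

end
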